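(* Let $\kappa$ be a signature wavelet and let $\sigma$ denote the signature with respect to $\kappa$. Let $f:\mathbb{R}\to\mathbb{R}$ be a locally integrable function of polynomial growth and let $b\in\mathbb{R}$. If there exists a neighborhood $V$ of $b$ such that $f$ is continuous on $V\setminus\{b\}$ and $f$ has a jump discontinuity at $b$, then $$\sigma f(b)=\begin{cases}+i,&\text{if } f(b^-)<f(b^+),\\ -i,&\text{if } f(b^-)>f(b^+).\end{cases}$$
   Context: The Fourier transform is $\widehat f(\omega)=\int_{\mathbb{R}}e^{-i\omega x}f(x)\,dx$. A signature wavelet is a non-zero complex-valued Schwartz function $\kappa\in\mathscr{S}(\mathbb{R},\mathbb{C})$ such that $\operatorname{supp}\widehat\kappa\subseteq[c,d]$ for some $0<c<d<\infty$ and $\widehat\kappa(\omega)\ge 0$ for all $\omega\in\mathbb{R}$. For $a>0$, $b\in\mathbb{R}$ put $\kappa_{a,b}(x)=\frac{1}{\sqrt a}\,\kappa\left(\frac{x-b}{a}\right)$. The pairing $\langle f,\phi\rangle$ of a tempered distribution with a Schwartz function is bilinear (no complex conjugation), i.e. $\langle f,\phi\rangle=\int f\phi\,dx$ for functions $f$. For $z\in\mathbb{C}\setminus\{0\}$, $\operatorname{sgn} z=z/|z|$, and $\operatorname{sgn}0=0$. The signature of $f$ at $b$ (with respect to $\kappa$) is $\sigma f(b)=\lim_{a\to0+}\operatorname{sgn}\langle f,\kappa_{a,b}\rangle$ if this limit exists in $\mathbb{C}$, and $\sigma f(b)=0$ otherwise. A function $f$ is of polynomial growth if there is $N\in\mathbb{N}$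 with $f\in O(|x|^N)$ as $|x|\to\infty$. A function $f$ has a jump discontinuity at $b$ if the left-hand limit $f(b^-)$ and the right-hand limit $f(b^+)$ exist but are not equal. *)

theory Defs
  imports "HOL-Analysis.Analysis" "HOL-Library.Landau_Symbols"
begin

(* The witness D is unique: D n is the n-th derivative of f. *)
definition schwartz :: "(real \<Rightarrow> complex) \<Rightarrow> bool" where
  "schwartz f \<longleftrightarrow> (\<exists>D :: nat \<Rightarrow> real \<Rightarrow> complex. D 0 = f \<and>
     (\<forall>n x. (D n has_vector_derivative D (Suc n) x) (at x)) \<and>
     (\<forall>m n. bounded (range (\<lambda>x. x ^ m *\<^sub>R D n x))))"

definition fourier :: "(real \<Rightarrow> complex) \<Rightarrow> real \<Rightarrow> complex" where
  "fourier f \<omega> = (LINT x|lebesgue. exp (- (\<i> * of_real (\<omega> * x))) * f x)"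

definition signature_wavelet :: "(real \<Rightarrow> complex) \<Rightarrow> bool" where
  "signature_wavelet \<kappa> \<longleftrightarrow> schwartz \<kappa> \<and> \<kappa> \<noteq> (\<lambda>_. 0) \<and>
     (\<exists>c d. 0 < c \<and> c < d \<and> closure {\<omega>. fourier \<kappa> \<omega> \<noteq> 0} \<subseteq> {c..d}) \<and>
     (\<forall>\<omega>. fourier \<kappa> \<omega> \<in> \<real>\<^sub>\<ge>\<^sub>0)"

definition wavelet_at :: "(real \<Rightarrow> complex) \<Rightarrow> real \<Rightarrow> real \<Rightarrow> real \<Rightarrow> complex" where
  "wavelet_at \<kappa> a b x = of_real (1 / sqrt a) * \<kappa> ((x - b) / a)"

(* The distribution induced by a function; bilinear, without complex conjugation. *)
definition regular_distribution :: "(real \<Rightarrow> complex) \<Rightarrow> (real \<Rightarrow> complex) \<Rightarrow> complex" where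
  "regular_distribution f \<phi> = (LINT x|lebesgue. f x * \<phi> x)"

(* T is a distribution, represented by its action on test functions.
   On complex numbers, sgn z = z / norm z and sgn 0 = 0. *)
definition signature ::
    "(real \<Rightarrow> complex) \<Rightarrow> ((real \<Rightarrow> complex) \<Rightarrow> complex) \<Rightarrow> real \<Rightarrow> complex" where
  "signature \<kappa> T b =
     (if \<exists>L. ((\<lambda>a. sgn (T (wavelet_at \<kappa> a b))) \<longlongrightarrow> L) (at_right 0)
      then Lim (at_right 0) (\<lambda>a. sgn (T (wavelet_at \<kappa> a b)))
      else 0)"

definition locally_integrable :: "(real \<Rightarrow> real) \<Rightarrow> bool" where
  "locally_integrable f \<longleftrightarrow> (\<forall>K. compact K \<longrightarrow> f absolutely_integrable_on K)"

definition polynomial_growth :: "(real \<Rightarrow> real) \<Rightarrow> bool" where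
  "polynomial_growth f \<longleftrightarrow> (\<exists>N::nat. f \<in> O[at_infinity](\<lambda>x. \<bar>x\<bar> ^ N))"

definition jump_discontinuity :: "(real \<Rightarrow> real) \<Rightarrow> real \<Rightarrow> bool" where
  "jump_discontinuity f b \<longleftrightarrow>
     (\<exists>l r. (f \<longlongrightarrow> l) (at_left b) \<and> (f \<longlongrightarrow> r) (at_right b) \<and> l \<noteq> r)"

end

theory Submission
  imports Defs "HOL-Probability.Sinc_Integral"
begin

text \<open>
  Write \<open>H\<close> for the integral of \<open>\<kappa>\<close> over the half-line from \<open>0\<close> to infinity. Up to the
  positive factor \<open>sqrt a\<close>, which \<open>sgn\<close> ignores, the pairing of \<open>f\<close> with the wavelet at
  scale \<open>a\<close> is the integral of \<open>f (b + a * y) * \<kappa> y\<close>. As \<open>a\<close> tends to \<open>0\<close> the dilated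
  \<open>f\<close> looks more and more like the step from \<open>l = f(b-)\<close> to \<open>r = f(b+)\<close>, and \<open>\<kappa>\<close> has
  mean zero because its Fourier transform vanishes at \<open>0\<close>. So the limit is \<open>(r - l) * H\<close>
  (lemma \<open>dilated_pairing_tendsto_jump\<close>): after subtracting the step, what is left of \<open>f\<close>
  tends to \<open>0\<close> at \<open>b\<close>, and the rapid decay of \<open>\<kappa>\<close> absorbs its polynomial growth.

  Everything then rests on \<open>H\<close> being \<open>\<i>\<close> times a positive number
  (lemma \<open>signature_wavelet_half_line_integral\<close>). Formally,
  \<open>H = (\<i> / (2 * pi)) * \<integral> fourier \<kappa> \<omega> / \<omega> d\<omega>\<close>, since the Fourier transform of the sign
  function is a multiple of \<open>1 / \<omega>\<close>. To prove this without Fourier inversion, Fubini is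
  applied to \<open>sin (\<omega> * (x - s)) / \<omega> * \<kappa> x\<close>, with \<open>\<omega>\<close> ranging over \<open>{0<..<T}\<close>. The
  \<open>\<omega>\<close>-integral is a sine integral, which stays bounded and tends to
  \<open>(pi / 2) * sgn (x - s)\<close>. The \<open>x\<close>-integral is a multiple of \<open>fourier \<kappa> \<omega>\<close>, because the
  negative frequencies of \<open>\<kappa>\<close> vanish.

  The shift \<open>s\<close> makes the same identity yield positivity. If the spectral
  integral, whose integrand is nonnegative, were zero, then \<open>fourier \<kappa>\<close> would vanish almost
  everywhere. The identity would then make the integral of \<open>\<kappa>\<close> over every half-line zero,
  and differentiating in \<open>s\<close> would give \<open>\<kappa> = 0\<close>.
\<close>

section \<open>Decay and integrability\<close>

lemma integrable_inverse_1_plus_square_lborel: "integrable lborel (\<lambda>x::real. inverse (1 + x^2))"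
  using integrable_inverse_1_plus_square
  by (simp add: set_integrable_def)

lemma schwartz_continuous:
  assumes "schwartz \<kappa>"
  shows "continuous_on UNIV \<kappa>"
proof -
  obtain D where D: "D 0 = \<kappa>" "\<And>n x. (D n has_vector_derivative D (Suc n) x) (at x)"
    using assms unfolding schwartz_def by blast
  have "isCont \<kappa> x" for x
    using has_vector_derivative_continuous[OF D(2)[of 0 x]] D(1) by simp
  then show ?thesis
    by (simp add: continuous_at_imp_continuous_on)
qed

lemma schwartz_decay:
  assumes "schwartz \<kappa>"
  obtains K where "K \<ge> 0" "\<And>x. \<bar>x\<bar> ^ m * norm (\<kappa> x) \<le> K"
proof -
  have "bounded (range (\<lambda>x. x ^ m *\<^sub>R \<kappa> x))"
    using assms unfolding schwartz_def by metis
  then obtain K where K: "\<And>x. norm (x ^ m *\<^sub>R \<kappa> x) \<le> K"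
    unfolding bounded_iff by auto
  then have "\<bar>x\<bar> ^ m * norm (\<kappa> x) \<le> K" for x
    by (simp add: power_abs)
  moreover have "K \<ge> 0"
    using norm_ge_zero K order_trans by blast
  ultimately show ?thesis
    using that by blast
qed

lemma schwartz_integrable_power:
  assumes "schwartz \<kappa>"
  shows "integrable lborel (\<lambda>x. x ^ m *\<^sub>R \<kappa> x)"
proof -
  obtain K where K: "K \<ge> 0" "\<And>x. \<bar>x\<bar> ^ m * norm (\<kappa> x) \<le> K"
    using schwartz_decay[OF assms, of m] by blast
  obtain L where L: "L \<ge> 0" "\<And>x. \<bar>x\<bar> ^ (m + 2) * norm (\<kappa> x) \<le> L"
    using schwartz_decay[OF assms, of "m + 2"] by blast
  note [continuous_intros] = schwartz_continuous[OF assms]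
  show ?thesis
  proof (rule Bochner_Integration.integrable_bound)
    show "integrable lborel (\<lambda>x::real. (K + L) * inverse (1 + x^2))"
      by (intro integrable_mult_right integrable_inverse_1_plus_square_lborel)
    show "(\<lambda>x. x ^ m *\<^sub>R \<kappa> x) \<in> borel_measurable lborel"
      by (simp, intro borel_measurable_continuous_onI continuous_intros)
    have "norm (x ^ m *\<^sub>R \<kappa> x) \<le> norm ((K + L) * inverse (1 + x\<^sup>2))" for x
    proof -
      have "(1 + x\<^sup>2) * (\<bar>x\<bar> ^ m * norm (\<kappa> x)) \<le> K + L"
        using K(2)[of x] L(2)[of x] by (simp add: algebra_simps power2_eq_square)
      then show ?thesis
        using K(1) L(1) by (simp add: field_simps power_abs add_pos_nonneg)
    qed
    then show "AE x in lborel. norm (x ^ m *\<^sub>R \<kappa> x) \<le> norm ((K + L) * inverse (1 + x\<^sup>2))"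
      by simp
  qed
qed

lemma schwartz_integrable:
  assumes "schwartz \<kappa>"
  shows "integrable lborel \<kappa>"
  using schwartz_integrable_power[OF assms, of 0] by simp

lemma fourier_eq_lborel:
  assumes "schwartz \<kappa>"
  shows "fourier \<kappa> \<omega> = (LINT x|lborel. exp (- (\<i> * of_real (\<omega> * x))) * \<kappa> x)"
  unfolding fourier_def
  using schwartz_continuous[OF assms]
  by (intro integral_completion) (auto intro!: borel_measurable_continuous_onI continuous_intros)

lemma locally_integrable_measurable:
  assumes "locally_integrable f"
  shows "f \<in> borel_measurable lebesgue"
proof (rule borel_measurable_LIMSEQ_real)
  fix n :: nat
  have "f absolutely_integrable_on {- real n..real n}"
    using assms by (auto simp: locally_integrable_def)
  then show "(\<lambda>x. indicator {- real n..real n} x *\<^sub>R f x) \<in> borel_measurable lebesgue"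
    unfolding set_integrable_def by (rule borel_measurable_integrable)
next
  fix x :: real
  have "eventually (\<lambda>n. real n \<ge> \<bar>x\<bar>) sequentially"
    using filterlim_real_sequentially by (rule filterlim_at_top[THEN iffD1, rule_format])
  then have "eventually (\<lambda>n. indicator {- real n..real n} x *\<^sub>R f x = f x) sequentially"
    by eventually_elim (auto simp: indicator_def)
  then show "(\<lambda>n. indicator {- real n..real n} x *\<^sub>R f x) \<longlonglongrightarrow> f x"
    by (rule tendsto_eventually)
qed

text \<open>
  The weight is a power of \<open>1 + x\<^sup>2\<close> because it is smooth and never zero: one formula serves
  near the origin, where local integrability is used, and far out, where one factor more than
  the growth order leaves an integrable \<open>1 / (1 + x\<^sup>2)\<close>.
\<close>
lemma weighted_integrable_of_polynomial_growth:
  assumes "locally_integrable f" "polynomial_growth f"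
  obtains N :: nat where "N \<ge> 1" "integrable lebesgue (\<lambda>x. f x / (1 + x\<^sup>2) ^ N)"
proof -
  obtain n :: nat where "f \<in> O[at_infinity](\<lambda>x. \<bar>x\<bar> ^ n)"
    using assms(2) unfolding polynomial_growth_def by blast
  then obtain C where C: "C > 0" "eventually (\<lambda>x. norm (f x) \<le> C * norm (\<bar>x\<bar> ^ n)) at_infinity"
    by (elim landau_o.bigE)
  then obtain R where R: "\<And>x. \<bar>x\<bar> \<ge> R \<Longrightarrow> \<bar>f x\<bar> \<le> C * \<bar>x\<bar> ^ n"
    unfolding eventually_at_infinity by auto
  have inner: "integrable lebesgue (\<lambda>x. indicator {-R..R} x *\<^sub>R f x)"
    using assms(1) unfolding locally_integrable_def set_integrable_def by blast
  have outer: "integrable lebesgue (\<lambda>x. C * inverse (1 + x\<^sup>2))"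
    by (intro integrable_mult_right integrable_completion[THEN iffD2]
          integrable_inverse_1_plus_square_lborel) auto
  have "integrable lebesgue (\<lambda>x. f x / (1 + x\<^sup>2) ^ (n + 1))"
  proof (rule Bochner_Integration.integrable_bound)
    show "integrable lebesgue
        (\<lambda>x. norm (indicator {-R..R} x *\<^sub>R f x) + C * inverse (1 + x\<^sup>2))"
      by (intro Bochner_Integration.integrable_add integrable_norm inner outer)
    have [measurable]: "f \<in> borel_measurable lebesgue"
      by (rule locally_integrable_measurable[OF assms(1)])
    have "(\<lambda>x::real. x) \<in> borel_measurable lebesgue"
      by (auto intro!: measurable_completion)
    note [measurable] = this
    show "(\<lambda>x. f x / (1 + x\<^sup>2) ^ (n + 1)) \<in> borel_measurable lebesgue"
      by measurable
    have "\<bar>f x\<bar> / (1 + x\<^sup>2) ^ (n + 1) \<le> indicator {-R..R} x * \<bar>f x\<bar> + C * inverse (1 + x\<^sup>2)" for x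
    proof (cases "x \<in> {-R..R}")
      case True
      have "1 \<le> (1 + x\<^sup>2) ^ (n + 1)"
        by (intro one_le_power) simp
      then have "\<bar>f x\<bar> / (1 + x\<^sup>2) ^ (n + 1) \<le> \<bar>f x\<bar> / 1"
        by (intro divide_left_mono) auto
      moreover have "0 \<le> C * inverse (1 + x\<^sup>2)"
        using C(1) by simp
      ultimately show ?thesis
        using True by simp
    next
      case False
      have "\<bar>x\<bar> \<le> 1 + x\<^sup>2"
        using sum_squares_ge_zero[of "\<bar>x\<bar> - 1/2" 0] by (simp add: power2_eq_square algebra_simps)
      then have "\<bar>x\<bar> ^ n \<le> (1 + x\<^sup>2) ^ n"
        by (intro power_mono) auto
      then have "\<bar>f x\<bar> \<le> C * (1 + x\<^sup>2) ^ n"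
        using R[of x] False C(1) by (smt (verit) atLeastAtMost_iff mult_left_mono)
      then have "\<bar>f x\<bar> / (1 + x\<^sup>2) ^ (n + 1) \<le> (C * (1 + x\<^sup>2) ^ n) / (1 + x\<^sup>2) ^ (n + 1)"
        by (intro divide_right_mono) auto
      also have "\<dots> = C * inverse (1 + x\<^sup>2)"
      proof -
        have "(1 + x\<^sup>2) \<noteq> 0" by (metis add_pos_nonneg less_irrefl zero_le_power2 zero_less_one)
        then show ?thesis by (simp add: divide_inverse)
      qed
      finally show ?thesis
        using False by simp
    qed
    then show "AE x in lebesgue. norm (f x / (1 + x\<^sup>2) ^ (n + 1))
        \<le> norm (norm (indicator {-R..R} x *\<^sub>R f x) + C * inverse (1 + x\<^sup>2))"
      using C(1) by (intro AE_I2) (simp add: abs_mult)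
  qed
  then show ?thesis
    using that[of "n + 1"] by simp
qed

section \<open>The half-line integral of a function with one-sided spectrum\<close>

lemma sine_kernel_integral:
  fixes T y :: real
  assumes "T \<ge> 0"
  shows "integrable lborel (\<lambda>\<omega>. indicator {0<..<T} \<omega> * (sin (\<omega> * y) / \<omega>))"
    and "(LINT \<omega>|lborel. indicator {0<..<T} \<omega> * (sin (\<omega> * y) / \<omega>)) = sgn y * Si (T * \<bar>y\<bar>)"
proof -
  have "interval_lebesgue_integrable lborel (ereal 0) (ereal T) (\<lambda>t. sin (t * y) / t)"
    by (rule integrable_sinc')
  then have "set_integrable lborel {0<..<T} (\<lambda>t. sin (t * y) / t)"
    using assms by (simp add: interval_lebesgue_integrable_def einterval_eq_Icc)
  then show "integrable lborel (\<lambda>\<omega>. indicator {0<..<T} \<omega> * (sin (\<omega> * y) / \<omega>))"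
    by (simp add: set_integrable_def)
  have "(LBINT t=ereal 0..ereal T. sin (t * y) / t) = sgn y * Si (T * \<bar>y\<bar>)"
    using LBINT_I0c_sin_scale_divide[OF assms, of y] by (simp add: zero_ereal_def)
  then show "(LINT \<omega>|lborel. indicator {0<..<T} \<omega> * (sin (\<omega> * y) / \<omega>)) = sgn y * Si (T * \<bar>y\<bar>)"
    using assms by (simp add: interval_integral_Ioo set_lebesgue_integral_def)
qed

lemma abs_sin_divide_le: "\<bar>sin (\<omega> * y) / \<omega>\<bar> \<le> \<bar>y :: real\<bar>"
proof (cases "\<omega> = 0")
  case False
  have "\<bar>sin (\<omega> * y)\<bar> \<le> \<bar>\<omega> * y\<bar>"
    by (rule abs_sin_x_le_abs_x)
  then show ?thesis
    using False by (simp add: field_simps abs_mult)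
qed simp

text \<open>
  The kernel \<open>sin (\<omega> * y) / \<omega>\<close> is at most \<open>\<bar>y\<bar>\<close> in absolute value, so a finite first moment
  of \<open>\<kappa>\<close> makes the double integral converge absolutely, the singularity of \<open>1 / \<omega>\<close> at \<open>0\<close>
  included.
\<close>
lemma sine_transform_swap:
  fixes \<kappa> :: "real \<Rightarrow> complex"
  assumes "integrable lborel \<kappa>" "integrable lborel (\<lambda>x. x *\<^sub>R \<kappa> x)" "T \<ge> 0"
  shows "(LINT \<omega>|lborel. indicator {0<..<T} \<omega> *\<^sub>R
            ((LINT x|lborel. sin (\<omega> * (x - s)) *\<^sub>R \<kappa> x) /\<^sub>R \<omega>))
       = (LINT x|lborel. (sgn (x - s) * Si (T * \<bar>x - s\<bar>)) *\<^sub>R \<kappa> x)"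
proof -
  let ?k = "\<lambda>x \<omega>. (indicator {0<..<T} \<omega> * (sin (\<omega> * (x - s)) / \<omega>)) *\<^sub>R \<kappa> x"
  have [measurable]: "\<kappa> \<in> borel_measurable borel"
    using assms(1) by (simp add: borel_measurable_integrable)
  have shift: "integrable lborel (\<lambda>x. (x - s) *\<^sub>R \<kappa> x)"
    using Bochner_Integration.integrable_diff[OF assms(2) integrable_scaleR_right[OF assms(1), of s]]
    by (simp add: algebra_simps)
  have "integrable (lborel \<Otimes>\<^sub>M lborel) (\<lambda>(x, \<omega>). ?k x \<omega>)"
  proof (rule lborel_pair.Fubini_integrable)
    show "(\<lambda>(x, \<omega>). ?k x \<omega>) \<in> borel_measurable (lborel \<Otimes>\<^sub>M lborel)"
      by measurable
    show "AE x in lborel. integrable lborel (\<lambda>\<omega>. case (x, \<omega>) of (x, \<omega>) \<Rightarrow> ?k x \<omega>)"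
      using sine_kernel_integral(1)[OF assms(3)] by (auto intro!: integrable_scaleR_left)
    show "integrable lborel (\<lambda>x. LINT \<omega>|lborel. norm (case (x, \<omega>) of (x, \<omega>) \<Rightarrow> ?k x \<omega>))"
    proof (rule Bochner_Integration.integrable_bound)
      show "integrable lborel (\<lambda>x. T * norm ((x - s) *\<^sub>R \<kappa> x))"
        by (intro integrable_mult_right integrable_norm shift)
      show "(\<lambda>x. LINT \<omega>|lborel. norm (case (x, \<omega>) of (x, \<omega>) \<Rightarrow> ?k x \<omega>)) \<in> borel_measurable lborel"
        by measurable
      have "norm (LINT \<omega>|lborel. norm (?k x \<omega>)) \<le> norm (T * norm ((x - s) *\<^sub>R \<kappa> x))" for x
      proof -
        have i: "integrable lborel (\<lambda>\<omega>. indicator {0<..<T} \<omega> * norm ((x - s) *\<^sub>R \<kappa> x))"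
          using assms(3) by (intro integrable_mult_left integrable_real_indicator) auto
        have "(LINT \<omega>|lborel. norm (?k x \<omega>))
            \<le> (LINT \<omega>|lborel. indicator {0<..<T} \<omega> * norm ((x - s) *\<^sub>R \<kappa> x))"
        proof (rule integral_mono)
          show "integrable lborel (\<lambda>\<omega>. norm (?k x \<omega>))"
            using sine_kernel_integral(1)[OF assms(3)]
            by (intro integrable_norm integrable_scaleR_left) auto
          show "norm (?k x \<omega>) \<le> indicator {0<..<T} \<omega> * norm ((x - s) *\<^sub>R \<kappa> x)" for \<omega>
            using mult_right_mono[OF abs_sin_divide_le[of \<omega> "x - s"] norm_ge_zero[of "\<kappa> x"]]
            by (auto simp: abs_mult indicator_def)
        qed (rule i)
        also have "\<dots> = T * norm ((x - s) *\<^sub>R \<kappa> x)"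
          using assms(3) by simp
        finally show ?thesis
          using assms(3) by (simp add: integral_nonneg_AE)
      qed
      then show "AE x in lborel. norm (LINT \<omega>|lborel. norm (case (x, \<omega>) of (x, \<omega>) \<Rightarrow> ?k x \<omega>))
          \<le> norm (T * norm ((x - s) *\<^sub>R \<kappa> x))"
        by simp
    qed
  qed
  from lborel_pair.Fubini_integral[OF this]
  have "(LINT \<omega>|lborel. LINT x|lborel. ?k x \<omega>) = (LINT x|lborel. LINT \<omega>|lborel. ?k x \<omega>)" .
  moreover have "(LINT x|lborel. ?k x \<omega>) =
      indicator {0<..<T} \<omega> *\<^sub>R ((LINT x|lborel. sin (\<omega> * (x - s)) *\<^sub>R \<kappa> x) /\<^sub>R \<omega>)" for \<omega>
  proof -
    have "(LINT x|lborel. ?k x \<omega>) =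
        (LINT x|lborel. (indicator {0<..<T} \<omega> / \<omega>) *\<^sub>R (sin (\<omega> * (x - s)) *\<^sub>R \<kappa> x))"
      by (intro Bochner_Integration.integral_cong) auto
    also have "\<dots> = (indicator {0<..<T} \<omega> / \<omega>) *\<^sub>R (LINT x|lborel. sin (\<omega> * (x - s)) *\<^sub>R \<kappa> x)"
      by (rule integral_scaleR_right)
    finally show ?thesis
      by (simp add: divide_inverse)
  qed
  moreover have "(LINT \<omega>|lborel. ?k x \<omega>) = (sgn (x - s) * Si (T * \<bar>x - s\<bar>)) *\<^sub>R \<kappa> x" for x
    using sine_kernel_integral[OF assms(3), of "x - s"] by (subst integral_scaleR_left) auto
  ultimately show ?thesis
    by simp
qed

lemma sine_transform_tendsto:
  fixes \<kappa> :: "real \<Rightarrow> complex"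
  assumes "integrable lborel \<kappa>"
  shows "((\<lambda>T. LINT x|lborel. (sgn (x - s) * Si (T * \<bar>x - s\<bar>)) *\<^sub>R \<kappa> x)
           \<longlongrightarrow> (LINT x|lborel. (sgn (x - s) * (pi / 2)) *\<^sub>R \<kappa> x)) at_top"
proof -
  have [measurable]: "\<kappa> \<in> borel_measurable borel"
    using assms by (simp add: borel_measurable_integrable)
  obtain B where B: "\<And>T. \<bar>Si T\<bar> \<le> B"
    using bounded_Si by blast
  show ?thesis
  proof (rule integral_dominated_convergence_at_top)
    show "integrable lborel (\<lambda>x. B * norm (\<kappa> x))"
      by (intro integrable_mult_right integrable_norm assms)
    show "\<forall>\<^sub>F T in at_top. AE x in lborel.
        norm ((sgn (x - s) * Si (T * \<bar>x - s\<bar>)) *\<^sub>R \<kappa> x) \<le> B * norm (\<kappa> x)"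
    proof (intro always_eventually allI AE_I2)
      fix T x
      have "\<bar>sgn (x - s)\<bar> * \<bar>Si (T * \<bar>x - s\<bar>)\<bar> \<le> 1 * B"
        by (intro mult_mono B) (auto simp: sgn_real_def)
      then show "norm ((sgn (x - s) * Si (T * \<bar>x - s\<bar>)) *\<^sub>R \<kappa> x) \<le> B * norm (\<kappa> x)"
        by (auto simp: abs_mult intro!: mult_right_mono)
    qed
    show "AE x in lborel. ((\<lambda>T. (sgn (x - s) * Si (T * \<bar>x - s\<bar>)) *\<^sub>R \<kappa> x)
        \<longlongrightarrow> (sgn (x - s) * (pi / 2)) *\<^sub>R \<kappa> x) at_top"
    proof (intro AE_I2)
      fix x
      show "((\<lambda>T. (sgn (x - s) * Si (T * \<bar>x - s\<bar>)) *\<^sub>R \<kappa> x)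
        \<longlongrightarrow> (sgn (x - s) * (pi / 2)) *\<^sub>R \<kappa> x) at_top"
      proof (cases "x = s")
        case False
        have "filterlim (\<lambda>T. T * \<bar>x - s\<bar>) at_top at_top"
          using False by (intro filterlim_at_top_mult_tendsto_pos[OF tendsto_const] filterlim_ident) auto
        then have "((\<lambda>T. Si (T * \<bar>x - s\<bar>)) \<longlongrightarrow> pi / 2) at_top"
          by (rule filterlim_compose[OF Si_at_top])
        then show ?thesis
          by (intro tendsto_intros)
      qed simp
    qed
  qed measurable
qed


text \<open>
  Of the two exponentials that make up the sine, one picks out the frequency \<open>\<omega>\<close> and the other
  \<open>- \<omega>\<close>. For a spectrum on the positive side only the first survives, and this turns a
  real sine into a factor \<open>\<i>\<close>.
\<close>
lemma sine_transform_one_sided: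
  assumes "schwartz \<kappa>" "fourier \<kappa> (- \<omega>) = 0"
  shows "(LINT x|lborel. sin (\<omega> * (x - s)) *\<^sub>R \<kappa> x)
       = \<i> / 2 * exp (\<i> * of_real (\<omega> * s)) * fourier \<kappa> \<omega>"
proof -
  let ?e = "\<lambda>\<omega> x. exp (- (\<i> * of_real (\<omega> * x))) * \<kappa> x"
  have int: "integrable lborel (?e \<omega>)" for \<omega>
  proof (rule Bochner_Integration.integrable_bound[OF schwartz_integrable[OF assms(1)]])
    show "?e \<omega> \<in> borel_measurable lborel"
      using schwartz_continuous[OF assms(1)]
      by (auto intro!: borel_measurable_continuous_onI continuous_intros)
  qed (simp add: norm_mult)
  have "sin (\<omega> * (x - s)) *\<^sub>R \<kappa> x =
      \<i> / 2 * exp (\<i> * of_real (\<omega> * s)) * ?e \<omega> x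
      - \<i> / 2 * exp (- (\<i> * of_real (\<omega> * s))) * ?e (- \<omega>) x" for x
  proof -
    have sin_eq: "complex_of_real (sin (\<omega> * (x - s))) =
        \<i> / 2 * (exp (- (\<i> * of_real (\<omega> * (x - s)))) - exp (\<i> * of_real (\<omega> * (x - s))))"
      by (simp add: complex_eq_iff Re_exp Im_exp)
    have left: "exp (\<i> * of_real (\<omega> * s)) * exp (- (\<i> * of_real (\<omega> * x)))
        = exp (- (\<i> * of_real (\<omega> * (x - s))))"
      by (simp add: exp_add[symmetric] algebra_simps)
    have right: "exp (- (\<i> * of_real (\<omega> * s))) * exp (- (\<i> * of_real (- \<omega> * x)))
        = exp (\<i> * of_real (\<omega> * (x - s)))"
      by (simp add: exp_add[symmetric] algebra_simps)
    show ?thesis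
      unfolding scaleR_conv_of_real sin_eq left[symmetric] right[symmetric]
      by (simp only: algebra_simps)
  qed
  then have "(LINT x|lborel. sin (\<omega> * (x - s)) *\<^sub>R \<kappa> x) =
      (LINT x|lborel. \<i> / 2 * exp (\<i> * of_real (\<omega> * s)) * ?e \<omega> x
      - \<i> / 2 * exp (- (\<i> * of_real (\<omega> * s))) * ?e (- \<omega>) x)"
    by presburger
  also have "\<dots> = (LINT x|lborel. \<i> / 2 * exp (\<i> * of_real (\<omega> * s)) * ?e \<omega> x)
      - (LINT x|lborel. \<i> / 2 * exp (- (\<i> * of_real (\<omega> * s))) * ?e (- \<omega>) x)"
    by (rule Bochner_Integration.integral_diff) (rule integrable_mult_right, rule int)+
  also have "\<dots> = \<i> / 2 * exp (\<i> * of_real (\<omega> * s)) * fourier \<kappa> \<omega>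
      - \<i> / 2 * exp (- (\<i> * of_real (\<omega> * s))) * fourier \<kappa> (- \<omega>)"
    unfolding fourier_eq_lborel[OF assms(1)] by (simp only: integral_mult_right_zero)
  finally show ?thesis
    using assms(2) by simp
qed

text \<open>
  For \<open>T \<ge> d\<close> the frequency side of the swapped integral no longer depends on \<open>T\<close>, so it
  equals its limit, which is computed on the space side. The right-hand side is the
  convolution of \<open>\<kappa>\<close> with a multiple of the sign function, and the left-hand side
  its expression through the spectrum.
\<close>
lemma sgn_pairing_eq_spectral_integral:
  assumes \<kappa>: "schwartz \<kappa>"
    and band: "\<And>\<omega>. \<omega> \<le> 0 \<or> \<omega> \<ge> d \<Longrightarrow> fourier \<kappa> \<omega> = 0" and "d > 0"
  shows "(LINT \<omega>|lborel. indicator {0<..<d} \<omega> *\<^sub>R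
            ((exp (\<i> * of_real (\<omega> * s)) * fourier \<kappa> \<omega>) /\<^sub>R \<omega>))
       = - \<i> * pi * (LINT x|lborel. sgn (x - s) *\<^sub>R \<kappa> x)" (is "?Q = _")
proof -
  note int = schwartz_integrable[OF \<kappa>]
  have int1: "integrable lborel (\<lambda>x. x *\<^sub>R \<kappa> x)"
    using schwartz_integrable_power[OF \<kappa>, of 1] by simp
  have "(LINT x|lborel. (sgn (x - s) * Si (T * \<bar>x - s\<bar>)) *\<^sub>R \<kappa> x) = \<i> / 2 * ?Q" if "T \<ge> d" for T
  proof -
    have "(LINT x|lborel. (sgn (x - s) * Si (T * \<bar>x - s\<bar>)) *\<^sub>R \<kappa> x) =
        (LINT \<omega>|lborel. indicator {0<..<T} \<omega> *\<^sub>R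
            ((LINT x|lborel. sin (\<omega> * (x - s)) *\<^sub>R \<kappa> x) /\<^sub>R \<omega>))"
      using that \<open>d > 0\<close> by (intro sine_transform_swap[symmetric] int int1) auto
    also have "\<dots> = (LINT \<omega>|lborel. \<i> / 2 * (indicator {0<..<d} \<omega> *\<^sub>R
            ((exp (\<i> * of_real (\<omega> * s)) * fourier \<kappa> \<omega>) /\<^sub>R \<omega>)))"
    proof (rule Bochner_Integration.integral_cong[OF refl])
      fix \<omega> :: real
      show "indicator {0<..<T} \<omega> *\<^sub>R ((LINT x|lborel. sin (\<omega> * (x - s)) *\<^sub>R \<kappa> x) /\<^sub>R \<omega>)
          = \<i> / 2 * (indicator {0<..<d} \<omega> *\<^sub>R
            ((exp (\<i> * of_real (\<omega> * s)) * fourier \<kappa> \<omega>) /\<^sub>R \<omega>))"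
      proof (cases "\<omega> > 0")
        case True
        then have "fourier \<kappa> (- \<omega>) = 0"
          by (intro band) auto
        then show ?thesis
          using that band[of \<omega>] True
          by (auto simp: sine_transform_one_sided[OF \<kappa>] indicator_def)
      qed (simp add: indicator_def)
    qed
    also have "\<dots> = \<i> / 2 * ?Q"
      by (rule integral_mult_right_zero)
    finally show ?thesis .
  qed
  then have "eventually (\<lambda>T. (LINT x|lborel. (sgn (x - s) * Si (T * \<bar>x - s\<bar>)) *\<^sub>R \<kappa> x)
      = \<i> / 2 * ?Q) at_top"
    by (rule eventually_mono[OF eventually_ge_at_top[of d]])
  then have "((\<lambda>T. LINT x|lborel. (sgn (x - s) * Si (T * \<bar>x - s\<bar>)) *\<^sub>R \<kappa> x) \<longlongrightarrow> \<i> / 2 * ?Q) at_top"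
    by (rule tendsto_eventually)
  then have "\<i> / 2 * ?Q = (LINT x|lborel. (sgn (x - s) * (pi / 2)) *\<^sub>R \<kappa> x)"
    using sine_transform_tendsto[OF int, of s] by (rule tendsto_unique[rotated]) simp
  also have "\<dots> = (LINT x|lborel. (pi / 2) *\<^sub>R (sgn (x - s) *\<^sub>R \<kappa> x))"
    by (simp add: mult.commute)
  also have "\<dots> = (pi / 2) *\<^sub>R (LINT x|lborel. sgn (x - s) *\<^sub>R \<kappa> x)"
    by (rule integral_scaleR_right)
  \<comment> \<open>The factor \<open>- 2 * \<i>\<close> inverts \<open>\<i> / 2\<close>.\<close>
  finally have "(- 2 * \<i>) * (\<i> / 2 * ?Q) = (- 2 * \<i>) * ((pi / 2) *\<^sub>R (LINT x|lborel. sgn (x - s) *\<^sub>R \<kappa> x))"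
    by (rule arg_cong)
  then show ?thesis
    by (simp add: scaleR_conv_of_real)
qed

lemma integrable_sgn_pairing:
  fixes \<kappa> :: "real \<Rightarrow> complex"
  assumes "integrable lborel \<kappa>"
  shows "integrable lborel (\<lambda>x. sgn (x - s) *\<^sub>R \<kappa> x)"
proof (rule Bochner_Integration.integrable_bound[OF assms])
  have [measurable]: "\<kappa> \<in> borel_measurable borel"
    using assms by (simp add: borel_measurable_integrable)
  show "(\<lambda>x. sgn (x - s) *\<^sub>R \<kappa> x) \<in> borel_measurable lborel"
    by (simp add: sgn_real_def)
  show "AE x in lborel. norm (sgn (x - s) *\<^sub>R \<kappa> x) \<le> norm (\<kappa> x)"
    by (simp add: sgn_real_def)
qed

lemma sgn_pairing_eq_half_line_integral:
  fixes \<kappa> :: "real \<Rightarrow> complex"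
  assumes int: "integrable lborel \<kappa>" and mean: "(LINT x|lborel. \<kappa> x) = 0"
  shows "(LINT x|lborel. sgn (x - s) *\<^sub>R \<kappa> x) = 2 * (LINT x|lborel. indicator {s..} x *\<^sub>R \<kappa> x)"
proof -
  have i: "integrable lborel (\<lambda>x. indicator {s..} x *\<^sub>R \<kappa> x)"
    using int by (intro integrable_mult_indicator) auto
  have "(LINT x|lborel. sgn (x - s) *\<^sub>R \<kappa> x) =
      (LINT x|lborel. 2 * (indicator {s..} x *\<^sub>R \<kappa> x) - \<kappa> x)"
  proof (rule integral_cong_AE)
    have "AE x in lborel. x \<noteq> s"
      by (rule AE_lborel_singleton)
    then show "AE x in lborel. sgn (x - s) *\<^sub>R \<kappa> x = 2 * (indicator {s..} x *\<^sub>R \<kappa> x) - \<kappa> x"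
      by eventually_elim (auto simp: indicator_def sgn_real_def)
    show "(\<lambda>x. 2 * (indicator {s..} x *\<^sub>R \<kappa> x) - \<kappa> x) \<in> borel_measurable lborel"
      using i int by (intro borel_measurable_integrable Bochner_Integration.integrable_diff integrable_mult_right)
    show "(\<lambda>x. sgn (x - s) *\<^sub>R \<kappa> x) \<in> borel_measurable lborel"
      by (intro borel_measurable_integrable integrable_sgn_pairing int)
  qed
  also have "\<dots> = 2 * (LINT x|lborel. indicator {s..} x *\<^sub>R \<kappa> x) - (LINT x|lborel. \<kappa> x)"
    by (simp only: Bochner_Integration.integral_diff[OF integrable_mult_right[OF i] int]
        integral_mult_right_zero)
  finally show ?thesis
    using mean by simp
qed

text \<open>
  By the fundamental theorem of calculus \<open>\<kappa> x\<close> is the derivative at \<open>x\<close> of the integral from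
  \<open>x - 1\<close> to a variable endpoint, and that integral is a difference of two half-line integrals.
\<close>
lemma zero_of_half_line_integrals_zero:
  fixes \<kappa> :: "real \<Rightarrow> complex"
  assumes cont: "continuous_on UNIV \<kappa>" and int: "integrable lborel \<kappa>"
    and half: "\<And>s. (LINT x|lborel. indicator {s..} x *\<^sub>R \<kappa> x) = 0"
  shows "\<kappa> x = 0"
proof -
  have si: "set_integrable lborel {s..} \<kappa>" for s
    unfolding set_integrable_def using int by (intro integrable_mult_indicator) auto
  have zero: "integral {x - 1..u} \<kappa> = 0" if "u \<ge> x - 1" for u
  proof -
    have sub: "set_integrable lborel {x - 1..u} \<kappa>"
      by (rule set_integrable_subset[OF si[of "x - 1"]]) auto
    have "(LINT t|lborel. indicator {x - 1..} t *\<^sub>R \<kappa> t) =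
        (LINT t|lborel. indicator {x - 1..u} t *\<^sub>R \<kappa> t + indicator {u..} t *\<^sub>R \<kappa> t)"
    proof (rule integral_cong_AE)
      have "AE t in lborel. t \<noteq> u"
        by (rule AE_lborel_singleton)
      then show "AE t in lborel. indicator {x - 1..} t *\<^sub>R \<kappa> t =
          indicator {x - 1..u} t *\<^sub>R \<kappa> t + indicator {u..} t *\<^sub>R \<kappa> t"
        by eventually_elim (use that in \<open>auto simp: indicator_def\<close>)
      show "(\<lambda>t. indicator {x - 1..} t *\<^sub>R \<kappa> t) \<in> borel_measurable lborel"
        using si[of "x - 1"] unfolding set_integrable_def by (rule borel_measurable_integrable)
      show "(\<lambda>t. indicator {x - 1..u} t *\<^sub>R \<kappa> t + indicator {u..} t *\<^sub>R \<kappa> t)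
          \<in> borel_measurable lborel"
        using si[of u] sub unfolding set_integrable_def
        by (intro borel_measurable_add borel_measurable_integrable)
    qed
    also have "\<dots> = (LINT t|lborel. indicator {x - 1..u} t *\<^sub>R \<kappa> t)
        + (LINT t|lborel. indicator {u..} t *\<^sub>R \<kappa> t)"
      using si sub by (intro Bochner_Integration.integral_add) (auto simp: set_integrable_def)
    finally have "(LINT t:{x - 1..u}|lborel. \<kappa> t) = 0"
      using half by (simp add: set_lebesgue_integral_def)
    then show ?thesis
      using set_borel_integral_eq_integral(2)[OF sub] by simp
  qed
  have "((\<lambda>u. integral {x - 1..u} \<kappa>) has_vector_derivative \<kappa> x) (at x within {x - 1..x + 1})"
    by (rule integral_has_vector_derivative) (auto intro: continuous_on_subset[OF cont])
  then have "((\<lambda>u. integral {x - 1..u} \<kappa>) has_vector_derivative \<kappa> x) (at x)"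
    by (simp add: at_within_Icc_at)
  moreover have "((\<lambda>u. integral {x - 1..u} \<kappa>) has_vector_derivative 0) (at x)"
  proof (rule has_vector_derivative_transform_within_open)
    show "((\<lambda>u. 0) has_vector_derivative 0) (at x)"
      by simp
    show "0 = integral {x - 1..u} \<kappa>" if "u \<in> {x - 1<..}" for u
      using zero[of u] that by simp
  qed auto
  ultimately show ?thesis
    by (rule vector_derivative_unique_at)
qed

lemma signature_wavelet_mean_zero:
  assumes "signature_wavelet \<kappa>"
  shows "(LINT x|lborel. \<kappa> x) = 0"
proof -
  have \<kappa>: "schwartz \<kappa>"
    using assms by (simp add: signature_wavelet_def)
  obtain c d where "0 < c" "closure {\<omega>. fourier \<kappa> \<omega> \<noteq> 0} \<subseteq> {c..d}"
    using assms by (auto simp: signature_wavelet_def)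
  then have "fourier \<kappa> 0 = 0"
    using closure_subset[of "{\<omega>. fourier \<kappa> \<omega> \<noteq> 0}"] by force
  then show ?thesis
    by (simp add: fourier_eq_lborel[OF \<kappa>])
qed

text \<open>
  The phase of a signature at a jump comes from here. Membership of the spectrum in \<open>{c..d}\<close>
  with \<open>c > 0\<close> keeps \<open>fourier \<kappa> \<omega> / \<omega>\<close> integrable near \<open>0\<close>, and nonnegativity fixes
  the sign of its integral.
\<close>
lemma signature_wavelet_half_line_integral:
  assumes "signature_wavelet \<kappa>"
  obtains P :: real where "P > 0" "(LINT x|lborel. indicator {0..} x *\<^sub>R \<kappa> x) = \<i> * P"
proof -
  have \<kappa>: "schwartz \<kappa>" and nz: "\<kappa> \<noteq> (\<lambda>_. 0)"
    and nonneg: "\<And>\<omega>. fourier \<kappa> \<omega> \<in> \<real>\<^sub>\<ge>\<^sub>0"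
    using assms by (auto simp: signature_wavelet_def)
  obtain c d where cd: "0 < c" "c < d" "closure {\<omega>. fourier \<kappa> \<omega> \<noteq> 0} \<subseteq> {c..d}"
    using assms by (auto simp: signature_wavelet_def)
  then have supp: "fourier \<kappa> \<omega> = 0" if "\<omega> < c \<or> \<omega> > d" for \<omega>
    using closure_subset[of "{\<omega>. fourier \<kappa> \<omega> \<noteq> 0}"] that by force
  \<comment> \<open>The spectrum may touch \<open>d\<close>; the open interval up to \<open>d + 1\<close> contains all of it.\<close>
  have band: "fourier \<kappa> \<omega> = 0" if "\<omega> \<le> 0 \<or> \<omega> \<ge> d + 1" for \<omega>
    using supp that cd by force
  note int = schwartz_integrable[OF \<kappa>]
  have [measurable]: "\<kappa> \<in> borel_measurable borel"
    using int by (simp add: borel_measurable_integrable)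
  note mean = signature_wavelet_mean_zero[OF assms]
  define q where "q \<omega> = indicator {0<..<d + 1} \<omega> * (Re (fourier \<kappa> \<omega>) / \<omega>)" for \<omega> :: real
  have real: "fourier \<kappa> \<omega> = of_real (Re (fourier \<kappa> \<omega>))" "Re (fourier \<kappa> \<omega>) \<ge> 0" for \<omega>
    using nonneg[of \<omega>] by (auto simp: complex_nonneg_Reals_iff complex_eq_iff)
  have q_nonneg: "q \<omega> \<ge> 0" for \<omega>
    using real(2) by (auto simp: q_def indicator_def)
  have q_int: "integrable lborel q"
  proof (rule Bochner_Integration.integrable_bound)
    show "integrable lborel (\<lambda>\<omega>. indicator {0<..<d + 1} \<omega> * ((LINT x|lborel. norm (\<kappa> x)) / c))"
      using cd by (intro integrable_mult_left integrable_real_indicator) auto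
    show "q \<in> borel_measurable lborel"
      unfolding q_def[abs_def] fourier_eq_lborel[OF \<kappa>] by measurable
    have "norm (q \<omega>) \<le> norm (indicator {0<..<d + 1} \<omega> * ((LINT x|lborel. norm (\<kappa> x)) / c))" for \<omega>
    proof (cases "\<omega> \<ge> c")
      case True
      have "norm (fourier \<kappa> \<omega>) \<le> (LINT x|lborel. norm (exp (- (\<i> * of_real (\<omega> * x))) * \<kappa> x))"
        unfolding fourier_eq_lborel[OF \<kappa>] by (rule integral_norm_bound)
      then have "Re (fourier \<kappa> \<omega>) \<le> (LINT x|lborel. norm (\<kappa> x))"
        using complex_Re_le_cmod[of "fourier \<kappa> \<omega>"] by (simp add: norm_mult)
      then have "Re (fourier \<kappa> \<omega>) / \<omega> \<le> (LINT x|lborel. norm (\<kappa> x)) / c"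
        using True cd real(2) by (intro frac_le) auto
      then show ?thesis
        using q_nonneg[of \<omega>] True cd by (auto simp: q_def indicator_def)
    next
      case False
      then show ?thesis
        using supp[of \<omega>] by (simp add: q_def)
    qed
    then show "AE \<omega> in lborel. norm (q \<omega>) \<le>
        norm (indicator {0<..<d + 1} \<omega> * ((LINT x|lborel. norm (\<kappa> x)) / c))"
      by simp
  qed
  have spectral: "(LINT \<omega>|lborel. exp (\<i> * of_real (\<omega> * s)) * of_real (q \<omega>))
      = - 2 * \<i> * pi * (LINT x|lborel. indicator {s..} x *\<^sub>R \<kappa> x)" for s
  proof -
    have "(LINT \<omega>|lborel. exp (\<i> * of_real (\<omega> * s)) * of_real (q \<omega>)) =
       (LINT \<omega>|lborel. indicator {0<..<d + 1} \<omega> *\<^sub>R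
            ((exp (\<i> * of_real (\<omega> * s)) * fourier \<kappa> \<omega>) /\<^sub>R \<omega>))"
    proof (rule Bochner_Integration.integral_cong[OF refl])
      fix \<omega> :: real
      show "exp (\<i> * of_real (\<omega> * s)) * of_real (q \<omega>) =
        indicator {0<..<d + 1} \<omega> *\<^sub>R ((exp (\<i> * of_real (\<omega> * s)) * fourier \<kappa> \<omega>) /\<^sub>R \<omega>)"
        by (subst real(1)) (simp add: q_def scaleR_conv_of_real divide_inverse)
    qed
    also have "\<dots> = - \<i> * pi * (LINT x|lborel. sgn (x - s) *\<^sub>R \<kappa> x)"
      using cd by (intro sgn_pairing_eq_spectral_integral \<kappa> band) auto
    finally show ?thesis
      by (simp add: sgn_pairing_eq_half_line_integral[OF int mean])
  qed
  have "(LINT \<omega>|lborel. q \<omega>) \<noteq> 0"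
  proof
    assume "(LINT \<omega>|lborel. q \<omega>) = 0"
    then have ae: "AE \<omega> in lborel. q \<omega> = 0"
      using integral_nonneg_eq_0_iff_AE[OF q_int] q_nonneg by simp
    have "(LINT x|lborel. indicator {s..} x *\<^sub>R \<kappa> x) = 0" for s
    proof -
      have "(LINT \<omega>|lborel. exp (\<i> * of_real (\<omega> * s)) * of_real (q \<omega>)) = 0"
        by (rule integral_eq_zero_AE) (use ae in eventually_elim, simp)
      then show ?thesis
        using spectral[of s] by simp
    qed
    then have "\<kappa> x = 0" for x
      by (rule zero_of_half_line_integrals_zero[OF schwartz_continuous[OF \<kappa>] int])
    then show False
      using nz by auto
  qed
  then have pos: "(LINT \<omega>|lborel. q \<omega>) > 0"
    using q_nonneg by (simp add: less_le integral_nonneg_AE)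
  have "complex_of_real (LINT \<omega>|lborel. q \<omega>) = - 2 * \<i> * pi * (LINT x|lborel. indicator {0..} x *\<^sub>R \<kappa> x)"
    using spectral[of 0] by simp
  then have "(\<i> / (2 * pi)) * complex_of_real (LINT \<omega>|lborel. q \<omega>) =
      (\<i> / (2 * pi)) * (- 2 * \<i> * pi * (LINT x|lborel. indicator {0..} x *\<^sub>R \<kappa> x))"
    by (rule arg_cong)
  then have "(LINT x|lborel. indicator {0..} x *\<^sub>R \<kappa> x)
      = \<i> * of_real ((LINT \<omega>|lborel. q \<omega>) / (2 * pi))"
    by simp
  then show ?thesis
    using pos by (intro that[of "(LINT \<omega>|lborel. q \<omega>) / (2 * pi)"]) auto
qed


section \<open>Concentration at the base point\<close>

lemma dilated_lborel:
  fixes \<kappa> :: "real \<Rightarrow> 'a :: {banach, second_countable_topology}"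
  assumes "a > 0"
  shows "integrable lborel \<kappa> \<Longrightarrow> integrable lborel (\<lambda>x. \<kappa> ((x - b) / a) /\<^sub>R a)"
    and "(LINT x|lborel. h x *\<^sub>R (\<kappa> ((x - b) / a) /\<^sub>R a)) = (LINT y|lborel. h (b + a * y) *\<^sub>R \<kappa> y)"
proof -
  have eq: "(x - b) / a = - b / a + (1 / a) * x" for x
    by (simp add: diff_divide_distrib)
  have "integrable lborel (\<lambda>x. \<kappa> ((x - b) / a)) \<longleftrightarrow> integrable lborel \<kappa>"
    unfolding eq using assms by (intro lborel_integrable_real_affine_iff) auto
  then show "integrable lborel (\<lambda>x. \<kappa> ((x - b) / a) /\<^sub>R a)" if "integrable lborel \<kappa>"
    using that by (intro integrable_scaleR_right) simp
  have "(LINT x|lborel. h x *\<^sub>R (\<kappa> ((x - b) / a) /\<^sub>R a)) =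
      \<bar>a\<bar> *\<^sub>R (LINT y|lborel. h (b + a * y) *\<^sub>R (\<kappa> (((b + a * y) - b) / a) /\<^sub>R a))"
    using assms by (intro lborel_integral_real_affine) auto
  also have "(LINT y|lborel. h (b + a * y) *\<^sub>R (\<kappa> (((b + a * y) - b) / a) /\<^sub>R a))
      = (LINT y|lborel. (1 / a) *\<^sub>R (h (b + a * y) *\<^sub>R \<kappa> y))"
    using assms by (intro Bochner_Integration.integral_cong) (auto simp: inverse_eq_divide mult.commute)
  also have "\<dots> = (1 / a) *\<^sub>R (LINT y|lborel. h (b + a * y) *\<^sub>R \<kappa> y)"
    by (rule integral_scaleR_right)
  finally show "(LINT x|lborel. h x *\<^sub>R (\<kappa> ((x - b) / a) /\<^sub>R a)) = (LINT y|lborel. h (b + a * y) *\<^sub>R \<kappa> y)"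
    using assms by simp
qed

text \<open>
  Away from \<open>b\<close> the quantities \<open>(x - b)\<^sup>2\<close> and \<open>1 + x\<^sup>2\<close> are comparable. So the decay of \<open>\<kappa>\<close>
  of order \<open>2 * N\<close> yields both a power of \<open>a\<close> and the very weight that makes a function of
  polynomial growth integrable.
\<close>
lemma dilated_tail_bound:
  assumes "schwartz \<kappa>" "\<delta> > 0"
  obtains K where "K \<ge> 0"
    "\<And>a x. a > 0 \<Longrightarrow> \<bar>x - b\<bar> \<ge> \<delta> \<Longrightarrow> norm (\<kappa> ((x - b) / a)) \<le> K * a ^ (2 * N) / (1 + x\<^sup>2) ^ N"
proof -
  obtain K where K: "K \<ge> 0" "\<And>y. \<bar>y\<bar> ^ (2 * N) * norm (\<kappa> y) \<le> K"
    using schwartz_decay[OF assms(1), of "2 * N"] by blast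
  \<comment> \<open>Chosen so that \<open>1 + x\<^sup>2 \<le> M * (x - b)\<^sup>2\<close> as soon as \<open>\<bar>x - b\<bar> \<ge> \<delta>\<close>: the \<open>2\<close> comes from
    \<open>x\<^sup>2 \<le> 2 * (x - b)\<^sup>2 + 2 * b\<^sup>2\<close>, and the fraction dominates the remaining constant.\<close>
  define M where "M = (1 + 2 * b\<^sup>2) / \<delta>\<^sup>2 + 2"
  have M: "M \<ge> 0"
    by (simp add: M_def)
  have "norm (\<kappa> ((x - b) / a)) \<le> (K * M ^ N) * a ^ (2 * N) / (1 + x\<^sup>2) ^ N"
    if "a > 0" "\<bar>x - b\<bar> \<ge> \<delta>" for a x
  proof -
    have "\<delta>\<^sup>2 \<le> (x - b)\<^sup>2"
      using that(2) assms(2) by (simp add: abs_le_square_iff[symmetric])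
    then have "(1 + 2 * b\<^sup>2) / \<delta>\<^sup>2 * \<delta>\<^sup>2 \<le> (1 + 2 * b\<^sup>2) / \<delta>\<^sup>2 * (x - b)\<^sup>2"
      by (intro mult_left_mono) auto
    then have "1 + 2 * b\<^sup>2 \<le> (1 + 2 * b\<^sup>2) / \<delta>\<^sup>2 * (x - b)\<^sup>2"
      using assms(2) by simp
    moreover have "x\<^sup>2 \<le> 2 * (x - b)\<^sup>2 + 2 * b\<^sup>2"
      using zero_le_power2[of "x - 2 * b"] by (simp add: power2_eq_square algebra_simps)
    ultimately have "1 + x\<^sup>2 \<le> M * (x - b)\<^sup>2"
      by (simp add: M_def distrib_right)
    then have "(1 + x\<^sup>2) ^ N \<le> (M * (x - b)\<^sup>2) ^ N"
      by (intro power_mono) auto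
    then have "(1 + x\<^sup>2) ^ N * norm (\<kappa> ((x - b) / a))
        \<le> (M * (x - b)\<^sup>2) ^ N * norm (\<kappa> ((x - b) / a))"
      by (intro mult_right_mono) auto
    also have "\<dots> = M ^ N * a ^ (2 * N) * (\<bar>(x - b) / a\<bar> ^ (2 * N) * norm (\<kappa> ((x - b) / a)))"
      using that(1) by (simp add: power_mult power_mult_distrib power_divide)
    also have "\<dots> \<le> M ^ N * a ^ (2 * N) * K"
      using that(1) M by (intro mult_left_mono K(2)) auto
    finally show ?thesis
      by (simp add: pos_le_divide_eq add_pos_nonneg mult_ac)
  qed
  then show ?thesis
    using K(1) M by (intro that[of "K * M ^ N"]) auto
qed

text \<open>
  Within \<open>\<delta>\<close> of \<open>b\<close> the function \<open>g\<close> is small and the \<open>L\<^sup>1\<close> norm of \<open>\<kappa> ((x - b) / a) / a\<close>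
  does not depend on \<open>a\<close>. Outside, the tail bound beats the factor \<open>1 / a\<close> and leaves
  \<open>a ^ (2 * N - 1)\<close>, which tends to \<open>0\<close> since \<open>N \<ge> 1\<close>.
\<close>
lemma dilated_pairing_tendsto_zero:
  fixes g :: "real \<Rightarrow> real"
  assumes \<kappa>: "schwartz \<kappa>" and g0: "(g \<longlongrightarrow> 0) (at b)"
    and wint: "integrable lebesgue (\<lambda>x. g x / (1 + x\<^sup>2) ^ N)" and "N \<ge> 1"
  shows "\<forall>\<^sub>F a in at_right 0. integrable lebesgue (\<lambda>x. g x *\<^sub>R (\<kappa> ((x - b) / a) /\<^sub>R a))"
    and "((\<lambda>a. LINT x|lebesgue. g x *\<^sub>R (\<kappa> ((x - b) / a) /\<^sub>R a)) \<longlongrightarrow> 0) (at_right 0)"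
proof -
  define W where "W = (LINT x|lebesgue. \<bar>g x\<bar> / (1 + x\<^sup>2) ^ N)"
  define A where "A = (LINT x|lborel. norm (\<kappa> x))"
  have w: "1 + x\<^sup>2 > 0" for x :: real
    by (simp add: add_pos_nonneg)
  have idm: "(\<lambda>x::real. x) \<in> borel_measurable lebesgue"
    by (auto intro!: measurable_completion)
  have "(\<lambda>x. g x / (1 + x\<^sup>2) ^ N * (1 + x\<^sup>2) ^ N) \<in> borel_measurable lebesgue"
    using idm by (intro borel_measurable_times borel_measurable_integrable[OF wint]
        borel_measurable_power borel_measurable_add borel_measurable_const) auto
  then have gm: "g \<in> borel_measurable lebesgue"
    using w by (simp add: less_imp_neq[symmetric])
  have wint': "integrable lebesgue (\<lambda>x. \<bar>g x\<bar> / (1 + x\<^sup>2) ^ N)"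
    using integrable_norm[OF wint] by simp
  have bound: "\<exists>K \<ge> 0. \<forall>a > 0.
      integrable lebesgue (\<lambda>x. g x *\<^sub>R (\<kappa> ((x - b) / a) /\<^sub>R a)) \<and>
      norm (LINT x|lebesgue. g x *\<^sub>R (\<kappa> ((x - b) / a) /\<^sub>R a)) \<le> \<epsilon> * A + K * a ^ (2 * N - 1) * W"
    if \<epsilon>: "\<epsilon> > 0" for \<epsilon>
  proof -
    obtain \<delta> where \<delta>: "\<delta> > 0" "\<And>x. x \<noteq> b \<Longrightarrow> \<bar>x - b\<bar> < \<delta> \<Longrightarrow> \<bar>g x\<bar> \<le> \<epsilon>"
      using tendstoD[OF g0 \<epsilon>] unfolding eventually_at
      by (auto simp: dist_real_def less_imp_le)
    obtain K where K: "K \<ge> 0"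
      "\<And>a x. a > 0 \<Longrightarrow> \<bar>x - b\<bar> \<ge> \<delta> \<Longrightarrow> norm (\<kappa> ((x - b) / a)) \<le> K * a ^ (2 * N) / (1 + x\<^sup>2) ^ N"
      using dilated_tail_bound[OF \<kappa> \<delta>(1)] by blast
    have "integrable lebesgue (\<lambda>x. g x *\<^sub>R (\<kappa> ((x - b) / a) /\<^sub>R a)) \<and>
      norm (LINT x|lebesgue. g x *\<^sub>R (\<kappa> ((x - b) / a) /\<^sub>R a)) \<le> \<epsilon> * A + K * a ^ (2 * N - 1) * W"
      if a: "a > 0" for a
    proof -
      let ?\<kappa> = "\<lambda>x. \<kappa> ((x - b) / a) /\<^sub>R a"
      let ?B = "\<lambda>x. \<epsilon> * norm (?\<kappa> x) + K * a ^ (2 * N - 1) * (\<bar>g x\<bar> / (1 + x\<^sup>2) ^ N)"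
      have \<kappa>a: "integrable lborel ?\<kappa>"
        using dilated_lborel(1)[OF a] schwartz_integrable[OF \<kappa>] by blast
      then have \<kappa>a': "integrable lebesgue ?\<kappa>"
        by (subst integrable_completion) auto
      have B: "integrable lebesgue ?B"
        by (intro Bochner_Integration.integrable_add integrable_mult_right integrable_norm \<kappa>a' wint')
      \<comment> \<open>The limit of \<open>g\<close> at \<open>b\<close> says nothing about the value \<open>g b\<close>, so that point is excluded.\<close>
      have "AE x in lebesgue. x \<noteq> b"
        by (intro AE_completion AE_lborel_singleton)
      then have le: "AE x in lebesgue. norm (g x *\<^sub>R ?\<kappa> x) \<le> ?B x"
      proof eventually_elim
        case (elim x)
        show ?case
        proof (cases "\<bar>x - b\<bar> < \<delta>")
          case True
          then have "\<bar>g x\<bar> * norm (?\<kappa> x) \<le> \<epsilon> * norm (?\<kappa> x)"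
            using elim by (intro mult_right_mono \<delta>(2)) auto
          moreover have "0 \<le> K * a ^ (2 * N - 1) * (\<bar>g x\<bar> / (1 + x\<^sup>2) ^ N)"
            using K(1) a w[of x] by simp
          ultimately show ?thesis
            unfolding norm_scaleR[of "g x"] by linarith
        next
          case False
          have "norm (?\<kappa> x) \<le> (K * a ^ (2 * N) / (1 + x\<^sup>2) ^ N) / a"
            using K(2)[OF a, of x] False a by (simp add: divide_right_mono divide_inverse mult.commute)
          also have "\<dots> = K * a ^ (2 * N - 1) / (1 + x\<^sup>2) ^ N"
            using a \<open>N \<ge> 1\<close> by (simp add: power_diff)
          finally have "\<bar>g x\<bar> * norm (?\<kappa> x) \<le> \<bar>g x\<bar> * (K * a ^ (2 * N - 1) / (1 + x\<^sup>2) ^ N)"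
            by (intro mult_left_mono) auto
          moreover have "0 \<le> \<epsilon> * norm (?\<kappa> x)"
            using \<open>\<epsilon> > 0\<close> by simp
          moreover have "\<bar>g x\<bar> * (K * a ^ (2 * N - 1) / (1 + x\<^sup>2) ^ N)
              = K * a ^ (2 * N - 1) * (\<bar>g x\<bar> / (1 + x\<^sup>2) ^ N)"
            by simp
          ultimately show ?thesis
            unfolding norm_scaleR[of "g x"] by linarith
        qed
      qed
      have int: "integrable lebesgue (\<lambda>x. g x *\<^sub>R ?\<kappa> x)"
      proof (rule Bochner_Integration.integrable_bound[OF B])
        show "(\<lambda>x. g x *\<^sub>R ?\<kappa> x) \<in> borel_measurable lebesgue"
          by (intro borel_measurable_scaleR gm borel_measurable_integrable[OF \<kappa>a'])
        show "AE x in lebesgue. norm (g x *\<^sub>R ?\<kappa> x) \<le> norm (?B x)"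
          using le by eventually_elim simp
      qed
      have "norm (LINT x|lebesgue. g x *\<^sub>R ?\<kappa> x) \<le> (LINT x|lebesgue. norm (g x *\<^sub>R ?\<kappa> x))"
        by (rule integral_norm_bound)
      also have "\<dots> \<le> (LINT x|lebesgue. ?B x)"
        by (rule integral_mono_AE[OF integrable_norm[OF int] B le])
      also have "\<dots> = \<epsilon> * (LINT x|lebesgue. norm (?\<kappa> x)) + K * a ^ (2 * N - 1) * W"
        unfolding W_def
        by (simp only: Bochner_Integration.integral_add[OF integrable_mult_right[OF integrable_norm[OF \<kappa>a']]
              integrable_mult_right[OF wint']] integral_mult_right_zero)
      also have "(LINT x|lebesgue. norm (?\<kappa> x)) = (LINT x|lborel. norm (?\<kappa> x))"
        by (rule integral_completion[OF borel_measurable_integrable[OF integrable_norm[OF \<kappa>a]]])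
      also have "\<dots> = A"
      proof -
        show ?thesis
          unfolding A_def using a dilated_lborel(2)[OF a, of "\<lambda>_. 1" "\<lambda>x. norm (\<kappa> x)" b] by simp
      qed
      finally show ?thesis
        using int by blast
    qed
    then show ?thesis
      using K(1) by blast
  qed
  show "\<forall>\<^sub>F a in at_right 0. integrable lebesgue (\<lambda>x. g x *\<^sub>R (\<kappa> ((x - b) / a) /\<^sub>R a))"
    using bound[of 1] by (auto intro: eventually_mono[OF eventually_at_right_less[of "0::real"]])
  show "((\<lambda>a. LINT x|lebesgue. g x *\<^sub>R (\<kappa> ((x - b) / a) /\<^sub>R a)) \<longlongrightarrow> 0) (at_right 0)"
  proof (rule tendstoI)
    fix e :: real
    assume "e > 0"
    have "A \<ge> 0"
      by (simp add: A_def integral_nonneg_AE)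
    \<comment> \<open>Adding \<open>1\<close> to \<open>A\<close> avoids a division by zero when \<open>\<kappa>\<close> vanishes.\<close>
    define \<epsilon> where "\<epsilon> = e / (2 * (A + 1))"
    have "\<epsilon> > 0" "\<epsilon> * A < e"
      using \<open>e > 0\<close> \<open>A \<ge> 0\<close> by (auto simp: \<epsilon>_def field_simps intro!: add_nonneg_pos)
    obtain K where K: "\<And>a. a > 0 \<Longrightarrow>
      norm (LINT x|lebesgue. g x *\<^sub>R (\<kappa> ((x - b) / a) /\<^sub>R a)) \<le> \<epsilon> * A + K * a ^ (2 * N - 1) * W"
      using bound[OF \<open>\<epsilon> > 0\<close>] by blast
    have "((\<lambda>a. \<epsilon> * A + K * a ^ (2 * N - 1) * W) \<longlongrightarrow> \<epsilon> * A + K * 0 ^ (2 * N - 1) * W) (at_right 0)"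
      by (intro tendsto_intros)
    then have "((\<lambda>a. \<epsilon> * A + K * a ^ (2 * N - 1) * W) \<longlongrightarrow> \<epsilon> * A) (at_right 0)"
      using \<open>N \<ge> 1\<close> by (simp add: power_0_left)
    from order_tendstoD(2)[OF this \<open>\<epsilon> * A < e\<close>] eventually_at_right_less[of "0::real"]
    show "\<forall>\<^sub>F a in at_right 0.
        dist (LINT x|lebesgue. g x *\<^sub>R (\<kappa> ((x - b) / a) /\<^sub>R a)) 0 < e"
    proof eventually_elim
      case (elim a)
      then show ?case
        using K[of a] by simp
    qed
  qed
qed

text \<open>
  A step at \<open>b\<close> is invariant under dilations about \<open>b\<close>, so its pairing with the dilated wavelet
  is the same at every scale.
\<close>
lemma dilated_pairing_step:
  assumes \<kappa>: "schwartz \<kappa>" and mean: "(LINT x|lborel. \<kappa> x) = 0" and "a > 0"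
  shows "integrable lebesgue (\<lambda>x. (if x < b then l else r) *\<^sub>R (\<kappa> ((x - b) / a) /\<^sub>R a))"
    and "(LINT x|lebesgue. (if x < b then l else r) *\<^sub>R (\<kappa> ((x - b) / a) /\<^sub>R a))
       = (r - l) *\<^sub>R (LINT x|lborel. indicator {0..} x *\<^sub>R \<kappa> x)"
proof -
  let ?\<kappa> = "\<lambda>x. \<kappa> ((x - b) / a) /\<^sub>R a"
  note int = schwartz_integrable[OF \<kappa>]
  have \<kappa>a: "integrable lborel ?\<kappa>"
    using dilated_lborel(1)[OF \<open>a > 0\<close>] int by blast
  have split: "(if x < c then l else r) *\<^sub>R v = l *\<^sub>R v + (r - l) *\<^sub>R (indicator {c..} x *\<^sub>R v)"
    for x c :: real and v :: complex
    by (auto simp: algebra_simps)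
  have i: "integrable lborel (\<lambda>x. (if x < b then l else r) *\<^sub>R ?\<kappa> x)"
    unfolding split by (intro Bochner_Integration.integrable_add integrable_scaleR_right
        integrable_mult_indicator \<kappa>a) auto
  note m = borel_measurable_integrable[OF i]
  show "integrable lebesgue (\<lambda>x. (if x < b then l else r) *\<^sub>R ?\<kappa> x)"
    using i by (subst integrable_completion[OF m])
  have "(LINT x|lebesgue. (if x < b then l else r) *\<^sub>R ?\<kappa> x)
      = (LINT x|lborel. (if x < b then l else r) *\<^sub>R ?\<kappa> x)"
    by (rule integral_completion[OF m])
  also have "\<dots> = (LINT y|lborel. (if b + a * y < b then l else r) *\<^sub>R \<kappa> y)"
    by (rule dilated_lborel(2)[OF \<open>a > 0\<close>])
  also have "\<dots> = (LINT y|lborel. (if y < 0 then l else r) *\<^sub>R \<kappa> y)"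
    using \<open>a > 0\<close> by (simp add: mult_less_0_iff)
  also have "\<dots> = (LINT y|lborel. l *\<^sub>R \<kappa> y) + (LINT y|lborel. (r - l) *\<^sub>R (indicator {0..} y *\<^sub>R \<kappa> y))"
    unfolding split by (intro Bochner_Integration.integral_add integrable_scaleR_right
      integrable_mult_indicator int) auto
  also have "\<dots> = (r - l) *\<^sub>R (LINT x|lborel. indicator {0..} x *\<^sub>R \<kappa> x)"
    using mean by (simp only: integral_scaleR_right) simp
  finally show "(LINT x|lebesgue. (if x < b then l else r) *\<^sub>R ?\<kappa> x)
     = (r - l) *\<^sub>R (LINT x|lborel. indicator {0..} x *\<^sub>R \<kappa> x)" .
qed

lemma dilated_pairing_tendsto_jump:
  assumes \<kappa>: "schwartz \<kappa>" and mean: "(LINT x|lborel. \<kappa> x) = 0"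
    and f: "locally_integrable f" "polynomial_growth f"
    and l: "(f \<longlongrightarrow> l) (at_left b)" and r: "(f \<longlongrightarrow> r) (at_right b)"
  shows "((\<lambda>a. LINT x|lebesgue. f x *\<^sub>R (\<kappa> ((x - b) / a) /\<^sub>R a))
     \<longlongrightarrow> (r - l) *\<^sub>R (LINT x|lborel. indicator {0..} x *\<^sub>R \<kappa> x)) (at_right 0)"
proof -
  define st where "st x = (if x < b then l else r)" for x
  define g where "g x = f x - st x" for x
  let ?H = "(r - l) *\<^sub>R (LINT x|lborel. indicator {0..} x *\<^sub>R \<kappa> x)"
  obtain N :: nat where N: "N \<ge> 1" "integrable lebesgue (\<lambda>x. f x / (1 + x\<^sup>2) ^ N)"
    using weighted_integrable_of_polynomial_growth[OF f] by blast
  have w: "1 + x\<^sup>2 > 0" for x :: real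
    by (simp add: add_pos_nonneg)
  have "integrable lborel (\<lambda>x. st x / (1 + x\<^sup>2) ^ N)"
  proof (rule Bochner_Integration.integrable_bound)
    show "integrable lborel (\<lambda>x. (\<bar>l\<bar> + \<bar>r\<bar>) * inverse (1 + x\<^sup>2))"
      by (intro integrable_mult_right integrable_inverse_1_plus_square_lborel)
    show "(\<lambda>x. st x / (1 + x\<^sup>2) ^ N) \<in> borel_measurable lborel"
      unfolding st_def by measurable
    have "norm (st x / (1 + x\<^sup>2) ^ N) \<le> norm ((\<bar>l\<bar> + \<bar>r\<bar>) * inverse (1 + x\<^sup>2))" for x
    proof -
      have "(1 + x\<^sup>2) ^ 1 \<le> (1 + x\<^sup>2) ^ N"
        using N(1) by (intro power_increasing) auto
      then have "\<bar>st x\<bar> / (1 + x\<^sup>2) ^ N \<le> (\<bar>l\<bar> + \<bar>r\<bar>) / (1 + x\<^sup>2)"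
        using w[of x] by (intro frac_le) (auto simp: st_def)
      then show ?thesis
        using w[of x] by (simp add: divide_inverse abs_mult)
    qed
    then show "AE x in lborel. norm (st x / (1 + x\<^sup>2) ^ N) \<le> norm ((\<bar>l\<bar> + \<bar>r\<bar>) * inverse (1 + x\<^sup>2))"
      by simp
  qed
  then have "integrable lebesgue (\<lambda>x. st x / (1 + x\<^sup>2) ^ N)"
    by (subst integrable_completion) auto
  then have gint: "integrable lebesgue (\<lambda>x. g x / (1 + x\<^sup>2) ^ N)"
    unfolding g_def diff_divide_distrib by (intro Bochner_Integration.integrable_diff N(2))
  have "(g \<longlongrightarrow> l - l) (at_left b)"
    by (rule Lim_transform_eventually[OF tendsto_diff[OF l tendsto_const[of l]]])
      (auto simp: eventually_at_left_field g_def st_def intro!: exI[of _ "b - 1"])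
  moreover have "(g \<longlongrightarrow> r - r) (at_right b)"
    by (rule Lim_transform_eventually[OF tendsto_diff[OF r tendsto_const[of r]]])
      (auto simp: eventually_at_right_field g_def st_def intro!: exI[of _ "b + 1"])
  ultimately have "(g \<longlongrightarrow> 0) (at b)"
    by (simp add: filterlim_at_split)
  note g = dilated_pairing_tendsto_zero[OF \<kappa> this gint N(1)]
  have "\<forall>\<^sub>F a in at_right 0. (LINT x|lebesgue. g x *\<^sub>R (\<kappa> ((x - b) / a) /\<^sub>R a)) + ?H
      = (LINT x|lebesgue. f x *\<^sub>R (\<kappa> ((x - b) / a) /\<^sub>R a))"
    using g(1) eventually_at_right_less[of "0::real"]
  proof eventually_elim
    case (elim a)
    have "(LINT x|lebesgue. f x *\<^sub>R (\<kappa> ((x - b) / a) /\<^sub>R a)) =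
        (LINT x|lebesgue. g x *\<^sub>R (\<kappa> ((x - b) / a) /\<^sub>R a) + st x *\<^sub>R (\<kappa> ((x - b) / a) /\<^sub>R a))"
      unfolding g_def by (simp only: scaleR_left.add[symmetric]) simp
    also have "\<dots> = (LINT x|lebesgue. g x *\<^sub>R (\<kappa> ((x - b) / a) /\<^sub>R a))
        + (LINT x|lebesgue. st x *\<^sub>R (\<kappa> ((x - b) / a) /\<^sub>R a))"
      unfolding st_def
      by (rule Bochner_Integration.integral_add[OF elim(1) dilated_pairing_step(1)[OF \<kappa> mean elim(2)]])
    also have "(LINT x|lebesgue. st x *\<^sub>R (\<kappa> ((x - b) / a) /\<^sub>R a)) = ?H"
      unfolding st_def by (rule dilated_pairing_step(2)[OF \<kappa> mean elim(2)])
    finally show ?case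
      by simp
  qed
  moreover have "((\<lambda>a. (LINT x|lebesgue. g x *\<^sub>R (\<kappa> ((x - b) / a) /\<^sub>R a)) + ?H) \<longlongrightarrow> 0 + ?H) (at_right 0)"
    by (intro tendsto_intros g(2))
  ultimately show ?thesis
    by (simp add: Lim_transform_eventually)
qed

section \<open>The signature at a jump\<close>

lemma sgn_regular_distribution_wavelet:
  assumes "a > 0"
  shows "sgn (regular_distribution (\<lambda>x. complex_of_real (f x)) (wavelet_at \<kappa> a b))
       = sgn (LINT x|lebesgue. f x *\<^sub>R (\<kappa> ((x - b) / a) /\<^sub>R a))"
proof -
  have a: "1 / sqrt a = sqrt a / a"
    using assms by (simp add: field_simps)
  have "regular_distribution (\<lambda>x. complex_of_real (f x)) (wavelet_at \<kappa> a b) =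
      (LINT x|lebesgue. sqrt a *\<^sub>R (f x *\<^sub>R (\<kappa> ((x - b) / a) /\<^sub>R a)))"
    unfolding regular_distribution_def wavelet_at_def a
    by (intro Bochner_Integration.integral_cong) (auto simp: scaleR_conv_of_real divide_inverse)
  also have "\<dots> = sqrt a *\<^sub>R (LINT x|lebesgue. f x *\<^sub>R (\<kappa> ((x - b) / a) /\<^sub>R a))"
    by (rule integral_scaleR_right)
  finally show ?thesis
    using assms by (simp add: sgn_scaleR)
qed

lemma signature_at_jump:
  assumes \<kappa>: "signature_wavelet \<kappa>" and f: "locally_integrable f" "polynomial_growth f"
    and l: "(f \<longlongrightarrow> l) (at_left b)" and r: "(f \<longlongrightarrow> r) (at_right b)" and "l \<noteq> r"
  shows "signature \<kappa> (regular_distribution (\<lambda>x. complex_of_real (f x))) b = sgn (r - l) *\<^sub>R \<i>"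
proof -
  have schw: "schwartz \<kappa>"
    using \<kappa> by (simp add: signature_wavelet_def)
  obtain P :: real where P: "P > 0" "(LINT x|lborel. indicator {0..} x *\<^sub>R \<kappa> x) = \<i> * P"
    using signature_wavelet_half_line_integral[OF \<kappa>] .
  let ?s = "\<lambda>a. sgn (regular_distribution (\<lambda>x. complex_of_real (f x)) (wavelet_at \<kappa> a b))"
  have "((\<lambda>a. sgn (LINT x|lebesgue. f x *\<^sub>R (\<kappa> ((x - b) / a) /\<^sub>R a)))
      \<longlongrightarrow> sgn ((r - l) *\<^sub>R (\<i> * P))) (at_right 0)"
    using dilated_pairing_tendsto_jump[OF schw signature_wavelet_mean_zero[OF \<kappa>] f l r] P \<open>l \<noteq> r\<close>
    by (intro tendsto_sgn) auto
  moreover have "sgn ((r - l) *\<^sub>R (\<i> * P)) = sgn (r - l) *\<^sub>R \<i>"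
    using P(1) by (simp add: sgn_scaleR sgn_mult sgn_of_real) (simp add: sgn_div_norm)
  moreover have "\<forall>\<^sub>F a in at_right 0. sgn (LINT x|lebesgue. f x *\<^sub>R (\<kappa> ((x - b) / a) /\<^sub>R a)) = ?s a"
    by (rule eventually_mono[OF eventually_at_right_less[of "0::real"]])
      (rule sgn_regular_distribution_wavelet[symmetric])
  ultimately have lim: "(?s \<longlongrightarrow> sgn (r - l) *\<^sub>R \<i>) (at_right 0)"
    by (simp only: Lim_transform_eventually)
  then have "Lim (at_right 0) ?s = sgn (r - l) *\<^sub>R \<i>"
    by (intro tendsto_Lim) auto
  then show ?thesis
    using lim by (auto simp: signature_def)
qed

theorem theorem4p2:
  fixes \<kappa> :: "real \<Rightarrow> complex" and f :: "real \<Rightarrow> real" and b :: real and V :: "real set"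
  assumes "signature_wavelet \<kappa>"
    and "locally_integrable f"
    and "polynomial_growth f"
    and "b \<in> interior V"
    and "continuous_on (V - {b}) f"
    and "jump_discontinuity f b"
  shows "(Lim (at_left b) f < Lim (at_right b) f \<longrightarrow>
            signature \<kappa> (regular_distribution (\<lambda>x. complex_of_real (f x))) b = \<i>) \<and>
         (Lim (at_left b) f > Lim (at_right b) f \<longrightarrow>
            signature \<kappa> (regular_distribution (\<lambda>x. complex_of_real (f x))) b = - \<i>)"
proof -
  obtain l r where lr: "(f \<longlongrightarrow> l) (at_left b)" "(f \<longlongrightarrow> r) (at_right b)" "l \<noteq> r"
    using assms(6) by (auto simp: jump_discontinuity_def)
  have "Lim (at_left b) f = l" "Lim (at_right b) f = r"
    using lr by (auto intro!: tendsto_Lim)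
  then show ?thesis
    using signature_at_jump[OF assms(1-3) lr] by (auto simp: sgn_real_def)
qed

end
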